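(* For any integers $d\geq 2$, $n\geq 1$ and $m\geq 2$, the generalized de Bruijn digraph $GB(d,d^mn)$ satisfies: 1. $Z(GB(d,d^mn))=(d-1)d^{m-1}n$; 2. $M(GB(d,d^mn))=(d-1)d^{m-1}n$; 3. $\mathrm{mr}(GB(d,d^mn))=d^{m-1}n$; 4. $\gamma_P(GB(d,d^mn))=(d-1)d^{m-2}n$.
   Context: Generalized de Bruijn digraph: for integers $d\geq 2$ and $N\geq 1$, $GB(d,N)$ has vertex set $\mathbb Z_N$, and each vertex $x$ has arcs to the vertices $(dx+t)\bmod N$ for $t\in\{0,1,\dots,d-1\}$. A digraph $H$ has vertex set $V(H)$ and arc set $A(H)\subseteq V(H)\times V(H)$; loops are allowed. $N^+_H(v)=\{u:(v,u)\in A(H)\}$, $N^+_H[v]=N^+_H(v)\cup\{v\}$, $N^+_H[S]=\bigcup_{v\in S}N^+_H[v]$. Zero forcing in a digraph $H$: for non-empty $S\subseteq V(H)$ put $B^0(S)=S$ and, for $i\ge 0$: if $H$ has no loops, $B^{i+1}(S)=B^i(S)\cup\{v\in V(H)\setminus B^i(S):\exists u\in B^i(S),\ N^+_H(u)\setminus B^i(S)=\{v\}\}$; if $H$ has at least one loop, $B^{i+1}(S)=B^i(S)\cup\{v\in V(H)\setminus B^i(S):\exists u\in V(H),\ N^+_H(u)\setminus B^i(S)=\{v\}\}$. $S$ is a zero forcing set if $B^k(S)=V(H)$ for some $k\ge 0$. $Z(H)$ is the minimum cardinality of a zero forcing set of $H$. Power domination in $H$: for non-empty $S\subseteq V(H)$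 put $P^0(S)=S$, $P^1(S)=N^+_H[S]$, and for $i\geq 1$ obtain $P^{i+1}(S)$ from $P^i(S)$ by the same rule by which $B^{i+1}(S)$ is obtained from $B^i(S)$ (the loopless rule if $H$ has no loops, the other rule if $H$ has at least one loop). $S$ is a power dominating set if $P^k(S)=V(H)$ for some $k\ge 0$. $\gamma_P(H)$ is the minimum cardinality of a power dominating set of $H$. Maximum nullity and minimum rank: for a digraph $H$ of order $p$, let $\mathcal S(H)$ be the set of real $p\times p$ matrices $X$ such that: if $H$ has no loops, for all $i\neq j$, $X_{i,j}\neq 0\Leftrightarrow (i,j)\in A(H)$ (diagonal arbitrary); if $H$ has at least one loop, for all $i,j$, $X_{i,j}\neq 0\Leftrightarrow (i,j)\in A(H)$. $M(H)=\max\{\dim\ker X:X\in\mathcal S(H)\}$ and $\mathrm{mr}(H)=\min\{\operatorname{rank}X:X\in\mathcal S(H)\}$. *)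

theory Defs
  imports "Graph_Theory.Pair_Digraph" "Jordan_Normal_Form.DL_Rank"
    "Jordan_Normal_Form.Matrix_Kernel"
begin

text \<open>
  Digraphs are finite \<^typ>\<open>'a pair_pre_digraph\<close>s: arcs are ordered pairs of vertices,
  and loops are allowed.
\<close>

definition gen_de_Bruijn :: "nat \<Rightarrow> nat \<Rightarrow> nat pair_pre_digraph" where
  "gen_de_Bruijn d N =
    \<lparr> pverts = {..<N}, parcs = {(x, (d * x + t) mod N) | x t. x < N \<and> t < d} \<rparr>"

lemma pair_fin_digraph_gen_de_Bruijn: "pair_fin_digraph (gen_de_Bruijn d N)"
proof -
  have sub: "parcs (gen_de_Bruijn d N) \<subseteq> {..<N} \<times> {..<N}"
    by (auto simp: gen_de_Bruijn_def intro!: mod_less_divisor)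
  then have "finite (parcs (gen_de_Bruijn d N))"
    by (rule finite_subset) simp
  with sub show ?thesis
    by unfold_locales (auto simp: gen_de_Bruijn_def)
qed

definition out_nbrs :: "'a pair_pre_digraph \<Rightarrow> 'a \<Rightarrow> 'a set" where
  "out_nbrs H v = {u. (v, u) \<in> parcs H}"

definition closed_out_nbrs :: "'a pair_pre_digraph \<Rightarrow> 'a set \<Rightarrow> 'a set" where
  "closed_out_nbrs H S = (\<Union>v\<in>S. insert v (out_nbrs H v))"

definition has_loop :: "'a pair_pre_digraph \<Rightarrow> bool" where
  "has_loop H \<longleftrightarrow> (\<exists>v. (v, v) \<in> parcs H)"


section \<open>Zero forcing and power domination\<close>

text \<open>
  In a loopless digraph only a vertex that is already in the set can force; as soon as the
  digraph has a loop somewhere, every vertex can.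
\<close>

definition force_step :: "'a pair_pre_digraph \<Rightarrow> 'a set \<Rightarrow> 'a set" where
  "force_step H B = B \<union>
    {v \<in> pverts H - B.
      \<exists>u \<in> (if has_loop H then pverts H else B). out_nbrs H u - B = {v}}"

primrec zf_iter :: "'a pair_pre_digraph \<Rightarrow> 'a set \<Rightarrow> nat \<Rightarrow> 'a set" where
  "zf_iter H S 0 = S"
| "zf_iter H S (Suc i) = force_step H (zf_iter H S i)"

definition zero_forcing_set :: "'a pair_pre_digraph \<Rightarrow> 'a set \<Rightarrow> bool" where
  "zero_forcing_set H S \<longleftrightarrow> S \<noteq> {} \<and> S \<subseteq> pverts H \<and> (\<exists>k. zf_iter H S k = pverts H)"

definition zero_forcing_number :: "'a pair_pre_digraph \<Rightarrow> nat" where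
  "zero_forcing_number H = Min {card S | S. zero_forcing_set H S}"

fun pd_iter :: "'a pair_pre_digraph \<Rightarrow> 'a set \<Rightarrow> nat \<Rightarrow> 'a set" where
  "pd_iter H S 0 = S"
| "pd_iter H S (Suc 0) = closed_out_nbrs H S"
| "pd_iter H S (Suc (Suc i)) = force_step H (pd_iter H S (Suc i))"

definition power_dominating_set :: "'a pair_pre_digraph \<Rightarrow> 'a set \<Rightarrow> bool" where
  "power_dominating_set H S \<longleftrightarrow> S \<noteq> {} \<and> S \<subseteq> pverts H \<and> (\<exists>k. pd_iter H S k = pverts H)"

definition power_domination_number :: "'a pair_pre_digraph \<Rightarrow> nat" where
  "power_domination_number H = Min {card S | S. power_dominating_set H S}"


section \<open>Maximum nullity and minimum rank\<close>

text \<open>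
  Row and column \<open>i\<close> of a matrix belong to the \<open>i\<close>-th smallest vertex. For a digraph on
  \<^term>\<open>{..<p} :: nat set\<close> this is vertex \<open>i\<close> itself.
\<close>

definition pattern_matrices :: "'a::linorder pair_pre_digraph \<Rightarrow> real mat set" where
  "pattern_matrices H =
    (let p = card (pverts H); vs = sorted_list_of_set (pverts H)
     in {X \<in> carrier_mat p p.
          \<forall>i<p. \<forall>j<p. has_loop H \<or> i \<noteq> j \<longrightarrow>
            (X $$ (i, j) \<noteq> 0 \<longleftrightarrow> (vs ! i, vs ! j) \<in> parcs H)})"

definition maximum_nullity :: "'a::linorder pair_pre_digraph \<Rightarrow> nat" where
  "maximum_nullity H = Max {kernel_dim X | X. X \<in> pattern_matrices H}"

definition minimum_rank :: "'a::linorder pair_pre_digraph \<Rightarrow> nat" where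
  "minimum_rank H = Min {vec_space.rank (card (pverts H)) X | X. X \<in> pattern_matrices H}"

end

theory Submission
  imports Defs "HOL-Number_Theory.Cong"
begin

text \<open>
  Let \<open>N = d * k\<close> and cut the vertex set into the \<open>k\<close> \<^emph>\<open>blocks\<close>
  \<open>{y. y div d = j}\<close> of \<open>d\<close> consecutive numbers. Since \<open>d * x + t\<close> reduces modulo \<open>d * k\<close> to
  \<open>d * (x mod k) + t\<close>, the out-neighbourhood of \<open>x\<close> is exactly the block with index
  \<open>x mod k\<close>, so distinct out-neighbourhoods are disjoint. Everything follows from this.

  \<^item> The vertex 0 has a loop, so every vertex may force, and a forcing step fills precisely the
    blocks that miss one vertex. A block that misses two vertices never changes. Hence forcing
    from \<open>B\<close> succeeds iff \<open>B\<close> misses at most one vertex of each block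
    (\<open>forcing_succeeds_iff\<close>), and the best zero forcing set misses one vertex of every block.

  \<^item> A matrix in the pattern class has in row \<open>i\<close> its non-zero entries exactly in the columns of
    block \<open>i mod k\<close>. One column from each block gives \<open>k\<close> columns with disjoint non-empty
    supports, so the rank is at least \<open>k\<close>; the 0/1 matrix of the pattern has only \<open>k\<close> different
    columns. The maximum nullity is then given by rank-nullity.

  \<^item> A power dominating set \<open>S\<close> must, for each block, either contain a vertex that dominates it or
    contain all but at most one of its vertices. A vertex of \<open>S\<close> dominates one block and lies in one block;
    giving the first role weight \<open>d - 1\<close> and the second weight 1, every block receives weight at
    least \<open>d - 1\<close>, so \<open>(d - 1) * k \<le> d * card S\<close>. For \<open>k = d * l\<close> this reads
    \<open>(d - 1) * l \<le> card S\<close>. Equality requires that no weight is wasted: \<open>S\<close> consists of \<open>l\<close> blocks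
    with one vertex removed from each, and it dominates every other block exactly once. Such a set
    comes from a permutation of the residues modulo \<open>l\<close> that sends each \<open>r\<close> to one of
    \<open>d * r, \<dots>, d * r + d - 1\<close> (\<open>gen_de_Bruijn_permutation\<close>).
\<close>

section \<open>Blocks and forcing\<close>

lemma add_mult_mod_mult:
  fixes d k x t :: nat
  assumes "t < d"
  shows "(d * x + t) mod (d * k) = d * (x mod k) + t"
  using assms by (simp add: mod_mult2_eq)

lemma arc_gen_de_Bruijn_iff:
  assumes "d > 0" "k > 0"
  shows "(x, y) \<in> parcs (gen_de_Bruijn d (d * k)) \<longleftrightarrow> x < d * k \<and> y div d = x mod k"
proof -
  have "(\<exists>t<d. y = (d * x + t) mod (d * k)) \<longleftrightarrow> y div d = x mod k"
  proof
    assume "\<exists>t<d. y = (d * x + t) mod (d * k)"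
    then show "y div d = x mod k"
      using assms by (auto simp: add_mult_mod_mult)
  next
    assume "y div d = x mod k"
    then have "y = d * (x mod k) + y mod d"
      by (metis mult_div_mod_eq)
    then show "\<exists>t<d. y = (d * x + t) mod (d * k)"
      using assms by (metis add_mult_mod_mult mod_less_divisor)
  qed
  then show ?thesis
    by (auto simp: gen_de_Bruijn_def)
qed

lemma out_nbrs_gen_de_Bruijn:
  assumes "d > 0" "k > 0" "x < d * k"
  shows "out_nbrs (gen_de_Bruijn d (d * k)) x = {y. y div d = x mod k}"
  using assms by (auto simp: out_nbrs_def arc_gen_de_Bruijn_iff)

lemma pverts_gen_de_Bruijn [simp]: "pverts (gen_de_Bruijn d N) = {..<N}"
  by (simp add: gen_de_Bruijn_def)

lemma has_loop_gen_de_Bruijn: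
  assumes "d > 0" "k > 0"
  shows "has_loop (gen_de_Bruijn d (d * k))"
proof -
  have "(0, 0) \<in> parcs (gen_de_Bruijn d (d * k))"
    using assms by (simp add: arc_gen_de_Bruijn_iff)
  then show ?thesis
    by (auto simp: has_loop_def)
qed

lemma div_less_iff_less_mult_left:
  fixes d k y :: nat
  assumes "d > 0"
  shows "y div d < k \<longleftrightarrow> y < d * k"
  using assms by (simp add: div_less_iff_less_mult mult.commute)

text \<open>
  Because the digraph has a loop, the forcing vertex need not belong to \<open>B\<close>; the vertex with number
  \<open>v div d\<close> points to the block of \<open>v\<close> and can always be used.
\<close>

lemma force_step_gen_de_Bruijn:
  assumes "d > 0" "k > 0"
  shows "force_step (gen_de_Bruijn d (d * k)) B =
    B \<union> {v. v < d * k \<and> {y. y div d = v div d} - B = {v}}"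
proof -
  have "(\<exists>u<d * k. out_nbrs (gen_de_Bruijn d (d * k)) u - B = {v}) \<longleftrightarrow>
      {y. y div d = v div d} - B = {v}" if v: "v < d * k" for v
  proof
    assume "\<exists>u<d * k. out_nbrs (gen_de_Bruijn d (d * k)) u - B = {v}"
    then obtain u where "u < d * k" and u: "{y. y div d = u mod k} - B = {v}"
      using assms by (auto simp: out_nbrs_gen_de_Bruijn)
    from u have "v div d = u mod k"
      by auto
    with u show "{y. y div d = v div d} - B = {v}"
      by simp
  next
    assume *: "{y. y div d = v div d} - B = {v}"
    have "v div d < k"
      using assms v by (simp add: div_less_iff_less_mult_left)
    moreover have "v div d < d * k"
      using v by (rule le_less_trans[OF div_le_dividend])
    ultimately show "\<exists>u<d * k. out_nbrs (gen_de_Bruijn d (d * k)) u - B = {v}"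
      using * assms by (intro exI[of _ "v div d"]) (simp add: out_nbrs_gen_de_Bruijn)
  qed
  then show ?thesis
    using has_loop_gen_de_Bruijn[OF assms] by (auto simp: force_step_def Bex_def)
qed

text \<open>
  Injectivity of \<open>y div d\<close> on the complement of \<open>B\<close> says that no block misses two vertices. Two
  missing vertices of one block obstruct each other forever; otherwise a single step fills everything.
\<close>

lemma forcing_succeeds_iff:
  assumes "d > 0" "k > 0" and B: "B \<subseteq> {..<d * k}"
  shows "(\<exists>i. (force_step (gen_de_Bruijn d (d * k)) ^^ i) B = {..<d * k}) \<longleftrightarrow>
    inj_on (\<lambda>y. y div d) ({..<d * k} - B)"
    (is "(\<exists>i. (?F ^^ i) B = ?V) \<longleftrightarrow> _")
proof
  assume "\<exists>i. (?F ^^ i) B = ?V"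
  then obtain i where i: "(?F ^^ i) B = ?V" ..
  show "inj_on (\<lambda>y. y div d) (?V - B)"
  proof (rule inj_onI, rule ccontr)
    fix y z
    assume yz: "y \<in> ?V - B" "z \<in> ?V - B" "y div d = z div d" "y \<noteq> z"
    have "y \<notin> (?F ^^ l) B \<and> z \<notin> (?F ^^ l) B" for l
    proof (induction l)
      case (Suc l)
      then show ?case
        using yz by (auto simp: force_step_gen_de_Bruijn[OF assms(1,2)])
    qed (use yz in auto)
    then show False
      using i yz by auto
  qed
next
  assume inj: "inj_on (\<lambda>y. y div d) (?V - B)"
  have "?F B = ?V"
  proof
    show "?F B \<subseteq> ?V"
      using B by (auto simp: force_step_gen_de_Bruijn[OF assms(1,2)])
    show "?V \<subseteq> ?F B"
    proof
      fix v assume v: "v \<in> ?V"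
      have "{y. y div d = v div d} - B = {v}" if "v \<notin> B"
      proof -
        have "y < d * k" if "y div d = v div d" for y
          using v that assms(1) by (metis div_less_iff_less_mult_left lessThan_iff)
        with that v inj show ?thesis
          by (auto dest!: inj_onD)
      qed
      then show "v \<in> ?F B"
        using v by (auto simp: force_step_gen_de_Bruijn[OF assms(1,2)])
    qed
  qed
  then show "\<exists>i. (?F ^^ i) B = ?V"
    by (intro exI[of _ 1]) simp
qed

section \<open>Zero forcing number\<close>

lemma zf_iter_eq_funpow: "zf_iter H S i = (force_step H ^^ i) S"
  by (induction i) auto

lemma zero_forcing_set_gen_de_Bruijn_iff:
  assumes "d > 0" "k > 0"
  shows "zero_forcing_set (gen_de_Bruijn d (d * k)) S \<longleftrightarrow>
    S \<noteq> {} \<and> S \<subseteq> {..<d * k} \<and> inj_on (\<lambda>y. y div d) ({..<d * k} - S)"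
  using forcing_succeeds_iff[OF assms, of S]
  by (auto simp: zero_forcing_set_def zf_iter_eq_funpow)

lemma Min_card_eqI:
  assumes "finite V" "\<And>S. P S \<Longrightarrow> S \<subseteq> V" "\<And>S. P S \<Longrightarrow> c \<le> card S" "P T" "card T = c"
  shows "Min {card S | S. P S} = c"
proof (rule Min_eqI)
  have "{card S | S. P S} \<subseteq> card ` Pow V"
    using assms(2) by auto
  then show "finite {card S | S. P S}"
    by (rule finite_subset) (use assms(1) in simp)
qed (use assms in auto)

text \<open>
  The complement of a zero forcing set injects into the set of blocks. The multiples of \<open>d\<close> form a
  transversal of the blocks, so their complement is optimal; it is non-empty because \<open>d \<ge> 2\<close>.
\<close>

lemma zero_forcing_number_gen_de_Bruijn:
  assumes "d \<ge> 2" "k > 0"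
  shows "zero_forcing_number (gen_de_Bruijn d (d * k)) = (d - 1) * k"
proof -
  let ?V = "{..<d * k}" and ?T = "(\<lambda>j. d * j) ` {..<k}"
  have T: "?T \<subseteq> ?V" and inj: "inj_on (\<lambda>j. d * j) {..<k}"
    using assms by (auto intro: inj_onI)
  have cardT: "card (?V - ?T) = (d - 1) * k"
    using T by (simp add: card_Diff_subset card_image[OF inj] diff_mult_distrib)
  have lower: "(d - 1) * k \<le> card S"
    if "S \<subseteq> ?V" "inj_on (\<lambda>y. y div d) (?V - S)" for S
  proof -
    have "card (?V - S) \<le> card {..<k}"
      by (rule card_inj_on_le[OF that(2)]) (use assms in \<open>auto simp: div_less_iff_less_mult_left\<close>)
    moreover have "card (?V - S) = d * k - card S"
      using that(1) by (simp add: card_Diff_subset finite_subset)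
    ultimately show ?thesis
      by (simp add: diff_mult_distrib)
  qed
  have "?V - ?T \<noteq> {}"
  proof -
    have "1 < d * k"
      using assms by (cases k) auto
    moreover have "1 \<notin> ?T"
      using assms by auto
    ultimately have "1 \<in> ?V - ?T"
      by simp
    then show ?thesis by blast
  qed
  moreover have "inj_on (\<lambda>y. y div d) (?V - (?V - ?T))"
    using assms by (auto intro!: inj_onI)
  ultimately have "zero_forcing_set (gen_de_Bruijn d (d * k)) (?V - ?T)"
    using assms by (simp add: zero_forcing_set_gen_de_Bruijn_iff)
  then show ?thesis
    unfolding zero_forcing_number_def using assms lower cardT
    by (intro Min_card_eqI[where V = ?V and T = "?V - ?T"])
      (auto simp: zero_forcing_set_gen_de_Bruijn_iff)
qed

section \<open>Power domination number\<close>

lemma pd_iter_Suc_eq_funpow: "pd_iter H S (Suc i) = (force_step H ^^ i) (closed_out_nbrs H S)"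
  by (induction i) auto

lemma closed_out_nbrs_gen_de_Bruijn:
  assumes "d > 0" "k > 0" "S \<subseteq> {..<d * k}"
  shows "closed_out_nbrs (gen_de_Bruijn d (d * k)) S =
    S \<union> {y. y div d \<in> (\<lambda>x. x mod k) ` S}"
proof -
  have "out_nbrs (gen_de_Bruijn d (d * k)) x = {y. y div d = x mod k}" if "x \<in> S" for x
    using assms that by (intro out_nbrs_gen_de_Bruijn) auto
  then show ?thesis
    by (auto simp: closed_out_nbrs_def)
qed

lemma power_dominating_set_gen_de_Bruijn_iff:
  assumes "d > 0" "k > 0"
  shows "power_dominating_set (gen_de_Bruijn d (d * k)) S \<longleftrightarrow>
    S \<noteq> {} \<and> S \<subseteq> {..<d * k} \<and>
    inj_on (\<lambda>y. y div d) {y. y < d * k \<and> y \<notin> S \<and> y div d \<notin> (\<lambda>x. x mod k) ` S}"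
proof (cases "S \<subseteq> {..<d * k}")
  case True
  let ?H = "gen_de_Bruijn d (d * k)" and ?V = "{..<d * k}"
  let ?C = "closed_out_nbrs ?H S"
  have C: "?C = S \<union> {y. y div d \<in> (\<lambda>x. x mod k) ` S}"
    by (rule closed_out_nbrs_gen_de_Bruijn[OF assms True])
  have "y < d * k" if "y div d \<in> (\<lambda>x. x mod k) ` S" for y
    using that assms by (auto simp flip: div_less_iff_less_mult_left)
  then have CV: "?C \<subseteq> ?V"
    using True by (auto simp: C)
  \<comment> \<open>Stage 0 is the whole vertex set only if \<open>S\<close> is, and then so is stage 1. Hence only the stages
    after the domination step matter, and those are a plain forcing process started at \<open>?C\<close>.\<close>
  have "(\<exists>i. pd_iter ?H S i = ?V) \<longleftrightarrow> (\<exists>i. pd_iter ?H S (Suc i) = ?V)"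
  proof
    assume "\<exists>i. pd_iter ?H S i = ?V"
    then obtain i where i: "pd_iter ?H S i = ?V" ..
    show "\<exists>i. pd_iter ?H S (Suc i) = ?V"
    proof (cases i)
      case 0
      with i CV have "pd_iter ?H S (Suc 0) = ?V"
        unfolding pd_iter.simps C by auto
      then show ?thesis ..
    qed (use i in blast)
  qed blast
  also have "\<dots> \<longleftrightarrow> inj_on (\<lambda>y. y div d) (?V - ?C)"
    unfolding pd_iter_Suc_eq_funpow by (rule forcing_succeeds_iff[OF assms CV])
  also have "?V - ?C = {y. y < d * k \<and> y \<notin> S \<and> y div d \<notin> (\<lambda>x. x mod k) ` S}"
    by (auto simp: C)
  finally show ?thesis
    by (simp add: power_dominating_set_def)
qed (simp add: power_dominating_set_def)

lemma card_vimage_div_le: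
  fixes d :: nat
  assumes "d > 0" "finite D"
  shows "finite {y. y div d \<in> D}" "card {y. y div d \<in> D} \<le> d * card D"
proof -
  have eq: "{y. y div d \<in> D} = (\<lambda>(j, t). d * j + t) ` (D \<times> {..<d})"
  proof
    show "{y. y div d \<in> D} \<subseteq> (\<lambda>(j, t). d * j + t) ` (D \<times> {..<d})"
    proof
      fix y assume "y \<in> {y. y div d \<in> D}"
      then show "y \<in> (\<lambda>(j, t). d * j + t) ` (D \<times> {..<d})"
        using assms by (intro image_eqI[of _ _ "(y div d, y mod d)"]) auto
    qed
  qed auto
  show "finite {y. y div d \<in> D}"
    unfolding eq using assms by simp
  have "card {y. y div d \<in> D} \<le> card (D \<times> {..<d})"
    unfolding eq using assms by (intro card_image_le) simp
  then show "card {y. y div d \<in> D} \<le> d * card D"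
    by (simp add: card_cartesian_product mult.commute)
qed

text \<open>
  The residues \<open>?D\<close> of \<open>S\<close> modulo \<open>k\<close> are the indices of the dominated blocks. The \<open>d * k\<close> vertices are covered by \<open>S\<close>, by
  the dominated blocks, which contribute at most \<open>d * card ?D\<close>, and by the vertices left to be
  forced, of which there is at most one in each of the \<open>k - card ?D\<close> undominated blocks. The bound
  follows from this count and \<open>card ?D \<le> card S\<close>.
\<close>

lemma power_dominating_set_card_ge:
  assumes "d > 0" "k > 0" and "power_dominating_set (gen_de_Bruijn d (d * k)) S"
  shows "(d - 1) * k \<le> d * card S"
proof -
  let ?V = "{..<d * k}" and ?D = "(\<lambda>x. x mod k) ` S"
  let ?U = "{y. y < d * k \<and> y \<notin> S \<and> y div d \<notin> ?D}"
  have S: "S \<subseteq> ?V" and inj: "inj_on (\<lambda>y. y div d) ?U"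
    using assms by (auto simp: power_dominating_set_gen_de_Bruijn_iff)
  have fin: "finite S"
    using S finite_subset by blast
  have D: "?D \<subseteq> {..<k}" and cardD: "card ?D \<le> card S"
    using assms fin by (auto intro: card_image_le)
  have "card ?U \<le> card ({..<k} - ?D)"
    by (rule card_inj_on_le[OF inj]) (use assms in \<open>auto simp: div_less_iff_less_mult_left\<close>)
  also have "\<dots> = k - card ?D"
    using D fin by (simp add: card_Diff_subset)
  finally have U: "card ?U \<le> k - card ?D" .
  have finD: "finite {y. y div d \<in> ?D}" and leD: "card {y. y div d \<in> ?D} \<le> d * card ?D"
    using card_vimage_div_le[of d ?D] assms fin by auto
  have "d * k = card ?V"
    by simp
  also have "\<dots> \<le> card (S \<union> {y. y div d \<in> ?D} \<union> ?U)"
    using fin finD by (intro card_mono) auto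
  also have "\<dots> \<le> card S + card {y. y div d \<in> ?D} + card ?U"
    by (meson add_mono_thms_linordered_semiring(3) card_Un_le le_trans)
  finally have "d * k \<le> card S + d * card ?D + (k - card ?D)"
    using U leD by linarith
  moreover have "card ?D \<le> k"
    using card_mono[OF _ D] by simp
  ultimately have "(d - 1) * k \<le> card S + (d - 1) * card ?D"
    using assms by (cases d) auto
  also have "\<dots> \<le> card S + (d - 1) * card S"
    using cardD by simp
  also have "\<dots> = d * card S"
    using assms by (cases d) auto
  finally show ?thesis .
qed

text \<open>
  In other words, \<open>gen_de_Bruijn d k\<close> has a spanning subdigraph in which all in- and out-degrees
  are 1. With \<open>g = gcd d k\<close> and \<open>q = k div g\<close>, the map \<open>r \<mapsto> d * r\<close> hits every multiple of \<open>g\<close> modulo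
  \<open>k\<close> exactly \<open>g\<close> times, once from each of the \<open>g\<close> intervals of length \<open>q\<close>. Shifting the image of the
  \<open>i\<close>-th interval by \<open>i\<close> sends the intervals to different residue classes modulo \<open>g\<close>.
\<close>

lemma gen_de_Bruijn_permutation:
  fixes d k :: nat
  assumes "d > 0" "k > 0"
  obtains t where "\<And>r. r < k \<Longrightarrow> t r < d"
    and "bij_betw (\<lambda>r. (d * r + t r) mod k) {..<k} {..<k}"
proof -
  define g where "g = gcd d k"
  define q where "q = k div g"
  define e where "e = d div g"
  have g: "g > 0" "k = g * q" "d = g * e" "g \<le> d"
    using assms by (auto simp: g_def q_def e_def intro: gcd_le1_nat)
  have cop: "coprime e q"
    using div_gcd_coprime[of d k] assms by (simp add: g_def q_def e_def)
  define t where "t r = r div q" for r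
  have tg: "t r < g" if "r < k" for r
    using that g by (simp add: t_def less_mult_imp_div_less)
  have "inj_on (\<lambda>r. (d * r + t r) mod k) {..<k}"
  proof (rule inj_onI)
    fix r s assume rs: "r \<in> {..<k}" "s \<in> {..<k}"
      and eq: "(d * r + t r) mod k = (d * s + t s) mod k"
    \<comment> \<open>Modulo \<open>g\<close> only the shift survives, which recovers the interval of \<open>r\<close>; the shift can then
      be cancelled, which recovers the position of \<open>r\<close> inside its interval.\<close>
    have "(d * r + t r) mod g = (d * s + t s) mod g"
      using eq g(2) by (metis mod_mult_right_eq mod_mod_cancel dvd_triv_left)
    then have t: "t r = t s"
      using rs g tg by (simp add: mult.assoc)
    then have "[d * r = d * s] (mod k)"
      using eq by (simp add: cong_def [symmetric] cong_add_rcancel_nat)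
    then have "[e * r = e * s] (mod q)"
      using g by (simp add: cong_def mult.assoc flip: mult_mod_right)
    then have "[r = s] (mod q)"
      using cop by (simp add: cong_mult_lcancel_nat)
    with t show "r = s"
      unfolding t_def cong_def by (metis div_mult_mod_eq)
  qed
  moreover have "(\<lambda>r. (d * r + t r) mod k) ` {..<k} \<subseteq> {..<k}"
    using assms by auto
  ultimately have "bij_betw (\<lambda>r. (d * r + t r) mod k) {..<k} {..<k}"
    by (simp add: bij_betw_def endo_inj_surj)
  moreover have "t r < d" if "r < k" for r
    using tg[OF that] g(4) by simp
  ultimately show ?thesis
    by (intro that[of t])
qed

text \<open>
  Let \<open>t\<close> describe the permutation above. The set \<open>J\<close> of block indices \<open>d * r + t r\<close> then has one element
  with each quotient \<open>r\<close> by \<open>d\<close> and one element in each residue class modulo \<open>k\<close>. The set \<open>S\<close>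
  consists of the blocks in \<open>J\<close>, where block \<open>b\<close> loses its vertex in position \<open>t (b mod k)\<close>. The
  vertex of block \<open>b\<close> in position \<open>s\<close> dominates block \<open>d * (b mod k) + s\<close>, so the blocks in \<open>J\<close> itself
  are precisely the ones that are not dominated, and each of them misses a single vertex.
\<close>

lemma power_dominating_set_exists:
  assumes "d \<ge> 2" "k > 0"
  obtains S where "power_dominating_set (gen_de_Bruijn d (d * (d * k))) S"
    and "card S \<le> (d - 1) * k"
proof -
  from assms have d: "d > 0" by simp
  obtain t where t: "\<And>r. r < k \<Longrightarrow> t r < d"
    and bij: "bij_betw (\<lambda>r. (d * r + t r) mod k) {..<k} {..<k}"
    using gen_de_Bruijn_permutation[OF d assms(2)] by blast
  define J where "J = (\<lambda>r. d * r + t r) ` {..<k}"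
  define S where "S = (\<Union>b\<in>J. (\<lambda>s. d * b + s) ` ({..<d} - {t (b mod k)}))"
  have J: "b < d * k" if "b \<in> J" for b
    using that t d by (auto simp: J_def simp flip: div_less_iff_less_mult_left)
  have "card S \<le> (\<Sum>b\<in>J. card ((\<lambda>s. d * b + s) ` ({..<d} - {t (b mod k)})))"
    unfolding S_def by (rule card_UN_le) (simp add: J_def)
  also have "\<dots> \<le> (\<Sum>b\<in>J. d - 1)"
  proof (rule sum_mono)
    fix b
    have "card ((\<lambda>s. d * b + s) ` ({..<d} - {t (b mod k)})) \<le> card ({..<d} - {t (b mod k)})"
      by (rule card_image_le) simp
    also have "\<dots> = d - 1"
      using t assms by simp
    finally show "card ((\<lambda>s. d * b + s) ` ({..<d} - {t (b mod k)})) \<le> d - 1" .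
  qed
  also have "\<dots> \<le> (d - 1) * k"
    using card_image_le[of "{..<k}" "\<lambda>r. d * r + t r"] by (simp add: J_def)
  finally have card: "card S \<le> (d - 1) * k" .
  have memS: "x \<in> S \<longleftrightarrow> x div d \<in> J \<and> x mod d \<noteq> t (x div d mod k)" for x
  proof
    assume "x div d \<in> J \<and> x mod d \<noteq> t (x div d mod k)"
    then show "x \<in> S"
      unfolding S_def using d by (intro UN_I[of "x div d"] image_eqI[of _ _ "x mod d"]) auto
  qed (auto simp: S_def)
  have SV: "S \<subseteq> {..<d * (d * k)}"
    using J d by (auto simp: memS simp flip: div_less_iff_less_mult_left)
  have "d - 1 \<noteq> 0"
    using assms by simp
  have "S \<noteq> {}"
  proof -
    let ?b = "d * 0 + t 0"
    have "?b \<in> J"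
      unfolding J_def using assms by blast
    moreover obtain s where "s < d" "s \<noteq> t (?b mod k)"
      using assms by (metis One_nat_def less_2_cases_iff less_le_trans zero_neq_one)
    ultimately have "d * ?b + s \<in> S"
      by (simp add: memS)
    then show ?thesis by blast
  qed
  moreover have "inj_on (\<lambda>y. y div d)
    {y. y < d * (d * k) \<and> y \<notin> S \<and> y div d \<notin> (\<lambda>x. x mod (d * k)) ` S}"
  proof -
    \<comment> \<open>A vertex that remains to be forced is determined by its block.\<close>
    have "y mod d = t (y div d mod k)"
      if y: "y < d * (d * k)" "y \<notin> S" "y div d \<notin> (\<lambda>x. x mod (d * k)) ` S" for y
    proof -
      define j where "j = y div d"
      have j: "j div d < k"
        using y d by (simp add: j_def div_less_iff_less_mult_left)
      have "j mod d = t (j div d)"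
      proof (rule ccontr)
        assume *: "j mod d \<noteq> t (j div d)"
        \<comment> \<open>Then block \<open>j\<close> is dominated, by the vertex in position \<open>j mod d\<close> of the block in \<open>J\<close> whose
          index is congruent to \<open>j div d\<close>; that vertex has not been removed.\<close>
        have "j div d \<in> (\<lambda>r. (d * r + t r) mod k) ` {..<k}"
          using bij j by (simp add: bij_betw_def)
        then obtain b where b: "b \<in> J" "b mod k = j div d"
          unfolding J_def by fastforce
        let ?x = "d * b + j mod d"
        have "?x \<in> S"
          using b * d by (simp add: memS)
        moreover have "?x mod (d * k) = j"
          using b d by (simp add: add_mult_mod_mult)
        ultimately show False
          using y(3) unfolding j_def by (metis imageI)
      qed
      then have "j \<in> J"
        unfolding J_def using j by (intro image_eqI[of _ _ "j div d"]) (simp_all flip: \<open>j mod d = _\<close>)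
      then show ?thesis
        using y(2) by (simp add: memS j_def)
    qed
    then show ?thesis
      by (intro inj_onI) (metis (mono_tags, lifting) mem_Collect_eq mult_div_mod_eq)
  qed
  ultimately have "power_dominating_set (gen_de_Bruijn d (d * (d * k))) S"
    using SV assms by (simp add: power_dominating_set_gen_de_Bruijn_iff)
  then show ?thesis
    using card by (rule that)
qed

lemma power_domination_number_gen_de_Bruijn:
  assumes "d \<ge> 2" "k > 0"
  shows "power_domination_number (gen_de_Bruijn d (d * (d * k))) = (d - 1) * k"
proof -
  let ?H = "gen_de_Bruijn d (d * (d * k))"
  have lower: "(d - 1) * k \<le> card S" if "power_dominating_set ?H S" for S
  proof -
    have "d * ((d - 1) * k) \<le> d * card S"
      using power_dominating_set_card_ge[of d "d * k" S] that assms by (simp add: mult.left_commute)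
    then show ?thesis
      using assms by simp
  qed
  obtain S where S: "power_dominating_set ?H S" "card S \<le> (d - 1) * k"
    using power_dominating_set_exists[OF assms] .
  then show ?thesis
    unfolding power_domination_number_def using lower
    by (intro Min_card_eqI[where V = "pverts ?H" and T = S])
      (auto simp: power_dominating_set_def intro!: antisym)
qed

section \<open>Rank and nullity\<close>

text \<open>
  Here \<^const>\<open>vec_space.rank\<close> is the dimension of the column span and \<^const>\<open>kernel_dim\<close> that of the
  null space; they are the image and the kernel of the linear map \<open>v \<mapsto> A v\<close>.
\<close>

lemma rank_plus_kernel_dim:
  fixes A :: "'a::field mat"
  assumes A: "A \<in> carrier_mat nr nc"
  shows "vec_space.rank nr A + kernel_dim A = nc"
proof -
  interpret K: kernel nr nc A
    by unfold_locales (rule A)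
  interpret C: vec_space "TYPE('a)" nr .
  interpret L: linear_map class_ring K.NC.V C.V "\<lambda>v. A *\<^sub>v v"
  proof unfold_locales
    show "(\<lambda>v. A *\<^sub>v v) \<in> LinearCombinations.module_hom class_ring K.NC.V C.V"
      using A by (auto simp: module_hom_def module_vec_simps mult_add_distrib_mat_vec mult_mat_vec)
  qed
  have "L.imT = C.span (set (cols A))"
  proof -
    have "C.span (set (cols A)) = {y \<in> carrier_vec nr. \<exists>x\<in>carrier_vec nc. A *\<^sub>v x = y}"
      using C.col_space_eq[OF A] A by (simp add: C.col_space_def)
    also have "\<dots> = (\<lambda>v. A *\<^sub>v v) ` carrier_vec nc"
      using A by (auto simp: image_iff)
    finally show ?thesis
      by (simp add: L.im_def module_vec_simps)
  qed
  moreover have "L.kerT = mat_kernel A"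
    using A by (auto simp: L.ker_def mat_kernel module_vec_simps)
  ultimately show ?thesis
    using L.rank_nullity K.NC.dim_is_n by (simp add: C.rank_def)
qed

lemma (in vec_space) rank_le_card_cols:
  assumes "A \<in> carrier_mat n nc"
  shows "rank A \<le> card (set (cols A))"
proof -
  obtain U where U: "maximal U (\<lambda>T. T \<subseteq> set (cols A) \<and> lin_indpt T)"
    using maximal_exists_superset[of "set (cols A)" "\<lambda>T. T \<subseteq> set (cols A) \<and> lin_indpt T" "{}"]
      finite_lin_indpt2[of "{}"] by auto
  then have "U \<subseteq> set (cols A)"
    by (simp add: maximal_def)
  then show ?thesis
    unfolding rank_card_indpt[OF assms U] by (simp add: card_mono)
qed

text \<open>
  If each column in \<open>J\<close> is the only one of them that is non-zero in some row \<open>\<rho> j\<close>, that row reads off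
  its coefficient in a linear combination, so the columns are independent.
\<close>

lemma (in vec_space) rank_ge_card_private_rows:
  assumes A: "A \<in> carrier_mat n nc" and J: "J \<subseteq> {..<nc}"
    and row: "\<And>j. j \<in> J \<Longrightarrow> \<rho> j < n"
    and diag: "\<And>j l. j \<in> J \<Longrightarrow> l \<in> J \<Longrightarrow> A $$ (\<rho> j, l) \<noteq> 0 \<longleftrightarrow> j = l"
  shows "card J \<le> rank A"
proof -
  have entry: "col A l $ \<rho> j = A $$ (\<rho> j, l)" if "j \<in> J" "l \<in> J" for j l
    using that A J row by (auto simp: subset_iff)
  have inj: "inj_on (col A) J"
    by (rule inj_onI) (metis diag entry)
  have fin: "finite J"
    using J finite_subset by blast
  have car: "col A ` J \<subseteq> carrier_vec n"
    using A by auto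
  have cols: "col A ` J \<subseteq> set (cols A)"
    using A J by (auto simp: cols_def)
  have "lin_indpt (col A ` J)"
  proof (rule finite_lin_indpt2)
    fix a assume lc: "lincomb a (col A ` J) = 0\<^sub>v n"
    show "\<forall>v\<in>col A ` J. a v = 0"
    proof
      fix v assume "v \<in> col A ` J"
      then obtain j where j: "j \<in> J" "v = col A j" by blast
      have "0 = lincomb a (col A ` J) $ \<rho> j"
        using lc row j by simp
      also have "\<dots> = (\<Sum>l\<in>J. a (col A l) * col A l $ \<rho> j)"
        using lincomb_index[OF row[OF j(1)] car] by (simp add: sum.reindex[OF inj])
      also have "\<dots> = (\<Sum>l\<in>J. if l = j then a (col A j) * A $$ (\<rho> j, j) else 0)"
        using diag j entry by (intro sum.cong) auto
      also have "\<dots> = a (col A j) * A $$ (\<rho> j, j)"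
        using fin j by simp
      finally show "a v = 0"
        using diag[OF j(1) j(1)] j by simp
    qed
  qed (use fin car in auto)
  from rank_ge_card_indpt[OF A cols this] show ?thesis
    by (simp add: card_image[OF inj])
qed

lemma pattern_matrices_gen_de_Bruijn:
  assumes "d > 0" "k > 0"
  shows "pattern_matrices (gen_de_Bruijn d (d * k)) =
    {X \<in> carrier_mat (d * k) (d * k).
      \<forall>i<d * k. \<forall>j<d * k. X $$ (i, j) \<noteq> 0 \<longleftrightarrow> j div d = i mod k}"
  using has_loop_gen_de_Bruijn[OF assms] assms
  by (auto simp: pattern_matrices_def Let_def arc_gen_de_Bruijn_iff lessThan_atLeast0)

text \<open>
  The first columns \<open>d * j\<close> of the blocks are taken, with row \<open>j < k\<close> as private row: it points to block
  \<open>j\<close> only.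
\<close>

lemma rank_pattern_matrix_ge:
  assumes "d > 0" "k > 0" "X \<in> pattern_matrices (gen_de_Bruijn d (d * k))"
  shows "k \<le> vec_space.rank (d * k) X"
proof -
  have X: "X \<in> carrier_mat (d * k) (d * k)"
    and nz: "\<And>i j. i < d * k \<Longrightarrow> j < d * k \<Longrightarrow> X $$ (i, j) \<noteq> 0 \<longleftrightarrow> j div d = i mod k"
    using assms by (auto simp: pattern_matrices_gen_de_Bruijn)
  have le: "i < d * k" if "i < k" for i
    using that assms by (simp add: less_le_trans)
  have "card ((\<lambda>j. d * j) ` {..<k}) \<le> vec_space.rank (d * k) X"
  proof (rule vec_space.rank_ge_card_private_rows[OF X, where \<rho> = "\<lambda>x. x div d"])
    fix j l assume "j \<in> (\<lambda>j. d * j) ` {..<k}" "l \<in> (\<lambda>j. d * j) ` {..<k}"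
    then obtain a b where ab: "a < k" "b < k" "j = d * a" "l = d * b"
      by blast
    then show "X $$ (j div d, l) \<noteq> 0 \<longleftrightarrow> j = l"
      using assms le[of a] nz[of a "d * b"] by auto
  qed (use assms le in auto)
  moreover have "inj_on (\<lambda>j. d * j) {..<k}"
    using assms by (auto intro: inj_onI)
  ultimately show ?thesis
    by (simp add: card_image)
qed

text \<open>In the 0/1 matrix a column depends only on its block, which leaves at most \<open>k\<close> columns.\<close>

lemma pattern_matrix_rank_attained:
  assumes "d > 0" "k > 0"
  obtains X where "X \<in> pattern_matrices (gen_de_Bruijn d (d * k))"
    and "vec_space.rank (d * k) X = k"
proof -
  define X :: "real mat" where
    "X = mat (d * k) (d * k) (\<lambda>(i, j). if j div d = i mod k then 1 else 0)"
  have car: "X \<in> carrier_mat (d * k) (d * k)"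
    by (simp add: X_def)
  have mem: "X \<in> pattern_matrices (gen_de_Bruijn d (d * k))"
    using assms by (simp add: pattern_matrices_gen_de_Bruijn X_def)
  let ?c = "\<lambda>b. vec (d * k) (\<lambda>i. if b = i mod k then 1 else (0::real))"
  have "col X j = ?c (j div d)" if "j < d * k" for j
    using that by (intro eq_vecI) (auto simp: X_def)
  then have "set (cols X) \<subseteq> ?c ` {..<k}"
    using assms by (auto simp: cols_def X_def div_less_iff_less_mult_left)
  then have "card (set (cols X)) \<le> k"
    by (metis card_lessThan finite_lessThan surj_card_le)
  then have "vec_space.rank (d * k) X \<le> k"
    using vec_space.rank_le_card_cols[OF car] by linarith
  with rank_pattern_matrix_ge[OF assms mem] mem show ?thesis
    by (intro that) auto
qed

lemma minimum_rank_gen_de_Bruijn: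
  assumes "d > 0" "k > 0"
  shows "minimum_rank (gen_de_Bruijn d (d * k)) = k"
proof -
  let ?R = "{vec_space.rank (d * k) X | X. X \<in> pattern_matrices (gen_de_Bruijn d (d * k))}"
  obtain Y where Y: "Y \<in> pattern_matrices (gen_de_Bruijn d (d * k))"
    "vec_space.rank (d * k) Y = k"
    using pattern_matrix_rank_attained[OF assms] .
  have "Min ?R = k"
  proof (rule Min_eqI)
    have "?R \<subseteq> {..d * k}"
      using assms vec_space.rank_le_nc by (auto simp: pattern_matrices_gen_de_Bruijn)
    then show "finite ?R"
      by (rule finite_subset) simp
    show "k \<in> ?R"
      using Y by force
  qed (use rank_pattern_matrix_ge[OF assms] in auto)
  then show ?thesis
    by (simp add: minimum_rank_def)
qed

lemma maximum_nullity_gen_de_Bruijn: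
  assumes "d > 0" "k > 0"
  shows "maximum_nullity (gen_de_Bruijn d (d * k)) = (d - 1) * k"
proof -
  let ?N = "{kernel_dim X | X. X \<in> pattern_matrices (gen_de_Bruijn d (d * k))}"
  obtain Y where Y: "Y \<in> pattern_matrices (gen_de_Bruijn d (d * k))"
    "vec_space.rank (d * k) Y = k"
    using pattern_matrix_rank_attained[OF assms] .
  have ker: "kernel_dim X = d * k - vec_space.rank (d * k) X"
    if "X \<in> pattern_matrices (gen_de_Bruijn d (d * k))" for X
    using that rank_plus_kernel_dim[of X "d * k" "d * k"] assms
    by (auto simp: pattern_matrices_gen_de_Bruijn)
  have le: "kernel_dim X \<le> d * k - k"
    if "X \<in> pattern_matrices (gen_de_Bruijn d (d * k))" for X
    using ker[OF that] rank_pattern_matrix_ge[OF assms that] by simp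
  have "Max ?N = d * k - k"
  proof (rule Max_eqI)
    have "?N \<subseteq> {..d * k - k}"
      using le by auto
    then show "finite ?N"
      by (rule finite_subset) simp
  qed (use Y ker[OF Y(1)] le in force)+
  then show ?thesis
    by (simp add: maximum_nullity_def diff_mult_distrib)
qed

section \<open>The digraphs of order \<open>d ^ m * n\<close>\<close>

theorem corollary5p3:
  fixes d n m :: nat
  assumes "d \<ge> 2" and "n \<ge> 1" and "m \<ge> 2"
  shows "zero_forcing_number (gen_de_Bruijn d (d ^ m * n)) = (d - 1) * d ^ (m - 1) * n
    \<and> maximum_nullity (gen_de_Bruijn d (d ^ m * n)) = (d - 1) * d ^ (m - 1) * n
    \<and> minimum_rank (gen_de_Bruijn d (d ^ m * n)) = d ^ (m - 1) * n
    \<and> power_domination_number (gen_de_Bruijn d (d ^ m * n)) = (d - 1) * d ^ (m - 2) * n"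
proof -
  obtain l where m: "m = Suc (Suc l)"
    using assms(3) by (metis add_2_eq_Suc le_Suc_ex)
  have N: "d ^ m * n = d * (d ^ (m - 1) * n)" "d ^ m * n = d * (d * (d ^ (m - 2) * n))"
    by (simp_all add: m)
  have pos: "d > 0" "d ^ (m - 1) * n > 0" "d ^ (m - 2) * n > 0"
    using assms by simp_all
  show ?thesis
    using zero_forcing_number_gen_de_Bruijn[OF assms(1) pos(2)]
      maximum_nullity_gen_de_Bruijn[OF pos(1,2)] minimum_rank_gen_de_Bruijn[OF pos(1,2)]
      power_domination_number_gen_de_Bruijn[OF assms(1) pos(3)]
    by (simp only: mult.assoc flip: N)
qed

end
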